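(* Let $(\mathcal W\times\mathcal T,\mathbf K(W|T))$ be a transition probability space (with $\mathcal T$ the set of environments), let $Y$ and $X_1,\dots,X_p$ be transitional random variables on it with values in $\mathcal Y$ and $\mathcal X_1,\dots,\mathcal X_p$, and let $E:=T$ be the deterministic transitional random variable $(w,t)\mapsto t$. For every $S\subseteq\{1,\dots,p\}$ the following statements are equivalent: 1. $S$ is invariant for $Y$, i.e. there exists a Markov kernel $\mathbf Q(Y|X_S):\mathcal X_S\dashrightarrow\mathcal Y$ (the same for all environments) such that $\mathbf K(Y,X_S|T)=\mathbf Q(Y|X_S)\otimes\mathbf K(X_S|T)$; 2. $Y\precsim^\ast_{\mathbf K}X_S$; 3. $Y\perp\!\!\!\perp_{\mathbf K(W|T)}\boldsymbol\delta_\ast\mid X_S$; 4. $Y\perp\!\!\!\perp_{\mathbf K(W|T)}E\mid X_S$.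
   Context: A Markov kernel $\mathbf K(W|T):\mathcal T\dashrightarrow\mathcal W$ between measurable spaces assigns to each $t$ a probability measure $\mathbf K(W|T=t)$ on $\mathcal W$, measurably in $t$ on each measurable set. A transition probability space is a pair $(\mathcal W\times\mathcal T,\mathbf K(W|T))$ with $\mathbf K(W|T):\mathcal T\dashrightarrow\mathcal W$ a Markov kernel. A transitional random variable is a Markov kernel $\mathbf X:\mathcal W\times\mathcal T\dashrightarrow\mathcal X$ (a measurable map is identified with its Dirac kernel). $\mathbf X\otimes\mathbf Y$ sends $(w,t)$ to the product measure of $\mathbf X(\cdot|w,t)$ and $\mathbf Y(\cdot|w,t)$. $X_S$ denotes the product of the $X_i$, $i\in S$, with values in $\mathcal X_S=\prod_{i\in S}\mathcal X_i$ (the constant variable for $S=\emptyset$). Joint kernels: $\mathbf K(X,Y,Z|T=t)(D)=\int(\mathbf X\otimes\mathbf Y\otimes\mathbf Z)(D|w,t)\,\mathbf K(W\in dw|T=t)$, with the corresponding marginals. The product of kernels: $(\mathbf Q(X|Z)\otimes\mathbf K(Y,Z|T))(A\times B\times C|t)=\int\mathbf 1_B(y)\mathbf 1_C(z)\mathbf Q(X\in A|Z=z)\,\mathbf K((Y,Z)\in d(y,z)|T=t)$. $\boldsymbol\delta_\ast$ is the constant transitional random variable with values in the one-point space. $\mathbf X\precsim^\ast_{\mathbf K}\mathbf Y$ means: there exists a Markov kernel $\mathbf Q(X|Y):\mathcal Y\dashrightarrow\mathcal X$ with $\mathbf K(X,Y|T)=\mathbf Q(X|Y)\otimes\mathbf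 K(Y|T)$. Transitional conditional independence: $\mathbf X\perp\!\!\!\perp_{\mathbf K(W|T)}\mathbf Y\mid\mathbf Z$ means: there exists a Markov kernel $\mathbf Q(X|Z):\mathcal Z\dashrightarrow\mathcal X$ with $\mathbf K(X,Y,Z|T)=\mathbf Q(X|Z)\otimes\mathbf K(Y,Z|T)$. *)

theory Defs
  imports "HOL-Probability.Probability"
begin

text \<open>
  Measurable spaces are represented by values of type \<^typ>\<open>'a measure\<close> of which only
  \<^const>\<open>space\<close> and \<^const>\<open>sets\<close> matter. The space \<^term>\<open>prob_algebra B\<close> of probability measures on
  \<open>B\<close> carries the smallest sigma-algebra making all evaluations on measurable sets
  measurable, so a measurable map into it is exactly a Markov kernel.
\<close>

abbreviation markov_kernel :: "'a measure \<Rightarrow> 'b measure \<Rightarrow> ('a \<Rightarrow> 'b measure) \<Rightarrow> bool" where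
  "markov_kernel A B Q \<equiv> Q \<in> A \<rightarrow>\<^sub>M prob_algebra B"

definition transition_prob_space :: "'w measure \<Rightarrow> 't measure \<Rightarrow> ('t \<Rightarrow> 'w measure) \<Rightarrow> bool" where
  "transition_prob_space W T K \<longleftrightarrow> markov_kernel T W K"

definition transitional_rv ::
    "'w measure \<Rightarrow> 't measure \<Rightarrow> 'x measure \<Rightarrow> ('w \<times> 't \<Rightarrow> 'x measure) \<Rightarrow> bool" where
  "transitional_rv W T MX X \<longleftrightarrow> markov_kernel (W \<Otimes>\<^sub>M T) MX X"

definition dirac_rv :: "'x measure \<Rightarrow> ('w \<times> 't \<Rightarrow> 'x) \<Rightarrow> 'w \<times> 't \<Rightarrow> 'x measure" where
  "dirac_rv MX f = (\<lambda>wt. return MX (f wt))"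

definition env_rv :: "'t measure \<Rightarrow> 'w \<times> 't \<Rightarrow> 't measure" where
  "env_rv T = dirac_rv T (\<lambda>(w, t). t)"

abbreviation one_point_space :: "unit measure" where
  "one_point_space \<equiv> count_space UNIV"

definition delta_star :: "'w \<times> 't \<Rightarrow> unit measure" where
  "delta_star = dirac_rv one_point_space (\<lambda>_. ())"

definition prod_rv ::
    "('w \<times> 't \<Rightarrow> 'x measure) \<Rightarrow> ('w \<times> 't \<Rightarrow> 'y measure) \<Rightarrow> 'w \<times> 't \<Rightarrow> ('x \<times> 'y) measure"
    (infixr "\<otimes>\<^sub>R" 75) where
  "X \<otimes>\<^sub>R Y = (\<lambda>wt. X wt \<Otimes>\<^sub>M Y wt)"

text \<open>
  The product of a finite family, with values in \<^term>\<open>PiM S MX\<close>. For \<open>S = {}\<close> that space has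
  exactly one point and the variable is constant.
\<close>

definition family_rv :: "'i set \<Rightarrow> ('i \<Rightarrow> 'w \<times> 't \<Rightarrow> 'x measure) \<Rightarrow> 'w \<times> 't \<Rightarrow> ('i \<Rightarrow> 'x) measure" where
  "family_rv S X = (\<lambda>wt. PiM S (\<lambda>i. X i wt))"

text \<open>
  \<open>kernel_of K V\<close> is the kernel \<open>K(V|T)\<close>; joint kernels \<open>K(X,Y,Z|T)\<close> are obtained for
  \<open>V = X \<otimes>\<^sub>R Y \<otimes>\<^sub>R Z\<close>. See \<open>emeasure_kernel_of\<close> for the integral formula.
\<close>

definition kernel_of :: "('t \<Rightarrow> 'w measure) \<Rightarrow> ('w \<times> 't \<Rightarrow> 'x measure) \<Rightarrow> 't \<Rightarrow> 'x measure" where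
  "kernel_of K V = (\<lambda>t. K t \<bind> (\<lambda>w. V (w, t)))"

text \<open>
  \<open>kernel_prod MB Q L\<close> is \<open>Q(A|B) \<otimes> L(B|T)\<close>: draw \<open>b\<close> from \<open>L t\<close>, then \<open>a\<close> from \<open>Q b\<close>, and
  return \<open>(a, b)\<close>. For \<open>B = (Y, Z)\<close> a kernel \<open>Q(X|Z)\<close> is passed as \<open>\<lambda>(y, z). Q z\<close>.
  See \<open>emeasure_kernel_prod\<close> and \<open>emeasure_kernel_prod3\<close> for the integral formulas.
\<close>

definition kernel_prod ::
    "'b measure \<Rightarrow> ('b \<Rightarrow> 'a measure) \<Rightarrow> ('t \<Rightarrow> 'b measure) \<Rightarrow> 't \<Rightarrow> ('a \<times> 'b) measure" where
  "kernel_prod MB Q L = (\<lambda>t. L t \<bind> (\<lambda>b. Q b \<Otimes>\<^sub>M return MB b))"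

text \<open>Kernels out of \<open>T\<close> are compared on \<^term>\<open>space T\<close> only.\<close>

definition kernel_eq :: "'t measure \<Rightarrow> ('t \<Rightarrow> 'a measure) \<Rightarrow> ('t \<Rightarrow> 'a measure) \<Rightarrow> bool" where
  "kernel_eq T L L' \<longleftrightarrow> (\<forall>t\<in>space T. L t = L' t)"

definition precsim_star ::
    "'t measure \<Rightarrow> ('t \<Rightarrow> 'w measure) \<Rightarrow> 'x measure \<Rightarrow> ('w \<times> 't \<Rightarrow> 'x measure) \<Rightarrow>
     'y measure \<Rightarrow> ('w \<times> 't \<Rightarrow> 'y measure) \<Rightarrow> bool" where
  "precsim_star T K MX X MY Y \<longleftrightarrow>
     (\<exists>Q. markov_kernel MY MX Q \<and>
          kernel_eq T (kernel_of K (X \<otimes>\<^sub>R Y)) (kernel_prod MY Q (kernel_of K Y)))"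

definition trans_cond_indep ::
    "'t measure \<Rightarrow> ('t \<Rightarrow> 'w measure) \<Rightarrow> 'x measure \<Rightarrow> ('w \<times> 't \<Rightarrow> 'x measure) \<Rightarrow>
     'y measure \<Rightarrow> ('w \<times> 't \<Rightarrow> 'y measure) \<Rightarrow> 'z measure \<Rightarrow> ('w \<times> 't \<Rightarrow> 'z measure) \<Rightarrow> bool" where
  "trans_cond_indep T K MX X MY Y MZ Z \<longleftrightarrow>
     (\<exists>Q. markov_kernel MZ MX Q \<and>
          kernel_eq T (kernel_of K (X \<otimes>\<^sub>R Y \<otimes>\<^sub>R Z))
            (kernel_prod (MY \<Otimes>\<^sub>M MZ) (\<lambda>(y, z). Q z) (kernel_of K (Y \<otimes>\<^sub>R Z))))"

definition invariant_for ::
    "'t measure \<Rightarrow> ('t \<Rightarrow> 'w measure) \<Rightarrow> 'y measure \<Rightarrow> ('w \<times> 't \<Rightarrow> 'y measure) \<Rightarrow>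
     ('i \<Rightarrow> 'x measure) \<Rightarrow> ('i \<Rightarrow> 'w \<times> 't \<Rightarrow> 'x measure) \<Rightarrow> 'i set \<Rightarrow> bool" where
  "invariant_for T K MY Y MX X S \<longleftrightarrow>
     (\<exists>Q. markov_kernel (PiM S MX) MY Q \<and>
          kernel_eq T (kernel_of K (Y \<otimes>\<^sub>R family_rv S X))
            (kernel_prod (PiM S MX) Q (kernel_of K (family_rv S X))))"

lemma emeasure_kernel_of:
  assumes K: "transition_prob_space W T K" and V: "transitional_rv W T MV V"
    and t: "t \<in> space T" and D: "D \<in> sets MV"
  shows "emeasure (kernel_of K V t) D = (\<integral>\<^sup>+ w. emeasure (V (w, t)) D \<partial>K t)"
proof -
  have Kt: "K t \<in> space (prob_algebra W)"
    using K t unfolding transition_prob_space_def by (rule measurable_space)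
  have "(\<lambda>w. V (w, t)) \<in> W \<rightarrow>\<^sub>M prob_algebra MV"
    using measurable_compose[OF measurable_Pair2'[OF t] V[unfolded transitional_rv_def]] .
  then show ?thesis
    unfolding kernel_of_def using Kt D by (intro emeasure_bind_prob_algebra)
qed

lemma emeasure_kernel_prod:
  assumes L: "markov_kernel T MB L" and Q: "markov_kernel MB MA Q"
    and t: "t \<in> space T" and A: "A \<in> sets MA" and B: "B \<in> sets MB"
  shows "emeasure (kernel_prod MB Q L t) (A \<times> B) = (\<integral>\<^sup>+ b. indicator B b * emeasure (Q b) A \<partial>L t)"
proof -
  have Lt: "L t \<in> space (prob_algebra MB)"
    using L t by (rule measurable_space)
  then have space: "space (L t) = space MB"
    by (intro sets_eq_imp_space_eq) (simp add: space_prob_algebra)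
  have f: "(\<lambda>b. Q b \<Otimes>\<^sub>M return MB b) \<in> MB \<rightarrow>\<^sub>M prob_algebra (MA \<Otimes>\<^sub>M MB)"
    by (intro measurable_pair_prob Q measurable_return_prob_space)
  have "emeasure (kernel_prod MB Q L t) (A \<times> B) =
      (\<integral>\<^sup>+ b. emeasure (Q b \<Otimes>\<^sub>M return MB b) (A \<times> B) \<partial>L t)"
    unfolding kernel_prod_def using A B by (intro emeasure_bind_prob_algebra[OF Lt f]) auto
  also have "\<dots> = (\<integral>\<^sup>+ b. indicator B b * emeasure (Q b) A \<partial>L t)"
  proof (rule nn_integral_cong)
    fix b assume "b \<in> space (L t)"
    then have b: "b \<in> space MB" by (simp add: space)
    interpret R: prob_space "return MB b" using b by (rule prob_space_return)
    have "sets (Q b) = sets MA"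
      using measurable_space[OF Q b] by (simp add: space_prob_algebra)
    then show "emeasure (Q b \<Otimes>\<^sub>M return MB b) (A \<times> B) = indicator B b * emeasure (Q b) A"
      using A B by (simp add: R.emeasure_pair_measure_Times mult.commute)
  qed
  finally show ?thesis .
qed

lemma emeasure_kernel_prod3:
  assumes L: "markov_kernel T (MY \<Otimes>\<^sub>M MZ) L" and Q: "markov_kernel MZ MX Q"
    and t: "t \<in> space T" and "A \<in> sets MX" "B \<in> sets MY" "C \<in> sets MZ"
  shows "emeasure (kernel_prod (MY \<Otimes>\<^sub>M MZ) (\<lambda>(y, z). Q z) L t) (A \<times> B \<times> C) =
    (\<integral>\<^sup>+ (y, z). indicator B y * indicator C z * emeasure (Q z) A \<partial>L t)"
proof -
  have "markov_kernel (MY \<Otimes>\<^sub>M MZ) MX (\<lambda>(y, z). Q z)"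
    using measurable_compose[OF measurable_snd Q] by (simp add: case_prod_beta')
  from emeasure_kernel_prod[OF L this t, of A "B \<times> C"] assms(4-6) show ?thesis
    by (simp add: indicator_times case_prod_beta')
qed

end

theory Submission
  imports Defs
begin

text \<open>
  Unfolding the definitions, all four statements ask for a Markov kernel \<open>Q\<close> from \<open>X\<^sub>S\<close> to \<open>Y\<close>
  that satisfies an equation between kernels out of \<open>T\<close>, and the first two ask for the same
  equation. The last two insert a middle variable \<open>U\<close>, namely \<open>\<delta>\<^sub>*\<close> or \<open>E\<close>, into the
  equation of the second. Two kernels out of \<open>T\<close> are equal as soon as they agree at every single
  \<open>t\<close>, and once \<open>t\<close> is fixed, the value of \<open>U\<close> is a point \<open>u t\<close> that does not depend on \<open>w\<close>: for
  the environment variable, \<open>u t = t\<close>. Hence at \<open>t\<close> both sides of the equation with \<open>U\<close> are the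
  images of both sides of the equation without \<open>U\<close> under \<open>(y, z) \<mapsto> (y, u t, z)\<close>. This map has the
  measurable left inverse \<open>(y, u, z) \<mapsto> (y, z)\<close>, so the image measures agree only if the original
  measures do, and one \<open>Q\<close> serves for all statements.

  This is \<open>trans_cond_indep_const_iff_precsim_star\<close>, which applies to any variable \<open>U\<close> that
  depends on \<open>t\<close> only. To apply it to a family \<open>X\<^sub>S\<close>, one also has to know that a finite product
  of Markov kernels is a Markov kernel (\<open>markov_kernel_PiM\<close>).
\<close>

lemma kernel_at:
  assumes "markov_kernel A B Q" "a \<in> space A"
  shows "prob_space (Q a)" "sets (Q a) = sets B" "space (Q a) = space B"
  using measurable_space[OF assms] by (auto simp: space_prob_algebra dest: sets_eq_imp_space_eq)

lemma emeasure_PiM_prob_space: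
  assumes "finite I" and prob: "\<And>i. i \<in> I \<Longrightarrow> prob_space (M i)"
    and A: "\<And>i. i \<in> I \<Longrightarrow> A i \<in> sets (M i)"
  shows "emeasure (PiM I M) (Pi\<^sub>E I A) = (\<Prod>i\<in>I. emeasure (M i) (A i))"
proof -
  (* The locale product_sigma_finite asks for sigma-finite measures at all indices, so those
     outside I are replaced by a Dirac measure. *)
  let ?M = "\<lambda>i. if i \<in> I then M i else return (count_space UNIV) undefined"
  have M: "prob_space (?M i)" for i
    using prob by (auto intro: prob_space_return)
  interpret product_sigma_finite ?M
    unfolding product_sigma_finite_def by (intro allI prob_space_imp_sigma_finite M)
  have "PiM I M = PiM I ?M"
    by (intro PiM_cong) auto
  then show ?thesis
    using emeasure_PiM[OF \<open>finite I\<close>, of A] A by simp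
qed

text \<open>
  The boxes generate the product sigma-algebra and are closed under intersection, so that it
  suffices that the measure of each box, a finite product, is measurable in the parameter.
\<close>

lemma markov_kernel_PiM:
  assumes I: "finite I" and Q: "\<And>i. i \<in> I \<Longrightarrow> markov_kernel N (M i) (Q i)"
  shows "markov_kernel N (PiM I M) (\<lambda>a. PiM I (\<lambda>i. Q i a))"
proof (rule measurable_prob_algebra_generated[OF sets_PiM Int_stable_prod_algebra
      prod_algebra_sets_into_space])
  fix a assume a: "a \<in> space N"
  show "prob_space (PiM I (\<lambda>i. Q i a))"
    using kernel_at(1)[OF Q a] by (intro prob_space_PiM)
  show "sets (PiM I (\<lambda>i. Q i a)) = sets (PiM I M)"
    using kernel_at(2)[OF Q a] by (intro sets_PiM_cong) auto
next
  fix B assume "B \<in> prod_algebra I M"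
  then obtain A where B: "B = Pi\<^sub>E I A" and A: "A \<in> (\<Pi> i\<in>I. sets (M i))"
    by (rule prod_algebraE_all)
  have "(\<lambda>a. \<Prod>i\<in>I. emeasure (Q i a) (A i)) \<in> borel_measurable N"
  proof (rule borel_measurable_prod_ennreal)
    fix i assume i: "i \<in> I"
    show "(\<lambda>a. emeasure (Q i a) (A i)) \<in> borel_measurable N"
      using A i by (intro measurable_compose[OF measurable_prob_algebraD[OF Q[OF i]]
            measurable_emeasure_subprob_algebra]) auto
  qed
  moreover have "emeasure (PiM I (\<lambda>i. Q i a)) B = (\<Prod>i\<in>I. emeasure (Q i a) (A i))"
    if a: "a \<in> space N" for a
    unfolding B using A kernel_at[OF Q a] by (intro emeasure_PiM_prob_space I) auto
  ultimately show "(\<lambda>a. emeasure (PiM I (\<lambda>i. Q i a)) B) \<in> borel_measurable N"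
    by (simp cong: measurable_cong)
qed

lemma pair_return_eq_distr:
  assumes N: "prob_space N" and u: "u \<in> space M"
  shows "return M u \<Otimes>\<^sub>M N = distr N (M \<Otimes>\<^sub>M N) (Pair u)"
proof -
  interpret N: prob_space N by fact
  interpret R: prob_space "return M u" using u by (rule prob_space_return)
  show ?thesis
  proof (rule pair_measure_eqI)
    fix A B assume A: "A \<in> sets (return M u)" and B: "B \<in> sets N"
    then have "Pair u -` (A \<times> B) \<inter> space N = (if u \<in> A then B else {})"
      by (auto dest: sets.sets_into_space)
    with A B u show "emeasure (return M u) A * emeasure N B = 
        emeasure (distr N (M \<Otimes>\<^sub>M N) (Pair u)) (A \<times> B)"
      by (subst emeasure_distr) auto
  qed (simp_all add: R.sigma_finite_measure_axioms N.sigma_finite_measure_axioms cong: sets_pair_measure_cong)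
qed

lemma distr_insert_middle:
  assumes A: "prob_space A" "sets A = sets MA" and B: "prob_space B" "sets B = sets MB"
    and u: "u \<in> space MU"
  shows "distr (A \<Otimes>\<^sub>M B) (MA \<Otimes>\<^sub>M MU \<Otimes>\<^sub>M MB) (\<lambda>(a, b). (a, u, b)) = A \<Otimes>\<^sub>M return MU u \<Otimes>\<^sub>M B"
proof -
  have eq: "return MU u \<Otimes>\<^sub>M B = distr B (MU \<Otimes>\<^sub>M B) (Pair u)"
    using B(1) u by (rule pair_return_eq_distr)
  have Pair: "Pair u \<in> B \<rightarrow>\<^sub>M MU \<Otimes>\<^sub>M B" using u by simp
  have "A \<Otimes>\<^sub>M return MU u \<Otimes>\<^sub>M B = distr A A (\<lambda>a. a) \<Otimes>\<^sub>M distr B (MU \<Otimes>\<^sub>M B) (Pair u)"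
    by (simp add: eq)
  also have "\<dots> = distr (A \<Otimes>\<^sub>M B) (A \<Otimes>\<^sub>M MU \<Otimes>\<^sub>M B) (\<lambda>(a, b). (a, u, b))"
    using prob_space.prob_space_distr[OF B(1) Pair]
    by (intro pair_measure_distr Pair prob_space_imp_sigma_finite) simp_all
  also have "\<dots> = distr (A \<Otimes>\<^sub>M B) (MA \<Otimes>\<^sub>M MU \<Otimes>\<^sub>M MB) (\<lambda>(a, b). (a, u, b))"
    using A(2) B(2) by (intro distr_cong sets_pair_measure_cong refl) simp_all
  finally show ?thesis ..
qed

text \<open>
  Forgetting the middle coordinate is measurable and undoes the insertion, so the image measure
  determines the original one.
\<close>

lemma distr_insert_middle_inj:
  assumes L: "sets L = sets (MA \<Otimes>\<^sub>M MB)" and L': "sets L' = sets (MA \<Otimes>\<^sub>M MB)"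
    and u: "u \<in> space MU"
    and eq: "distr L (MA \<Otimes>\<^sub>M MU \<Otimes>\<^sub>M MB) (\<lambda>(a, b). (a, u, b)) =
      distr L' (MA \<Otimes>\<^sub>M MU \<Otimes>\<^sub>M MB) (\<lambda>(a, b). (a, u, b))"
  shows "L = L'"
proof -
  have forget: "distr (distr N (MA \<Otimes>\<^sub>M MU \<Otimes>\<^sub>M MB) (\<lambda>(a, b). (a, u, b))) (MA \<Otimes>\<^sub>M MB)
      (\<lambda>(a, u, b). (a, b)) = N" if N: "sets N = sets (MA \<Otimes>\<^sub>M MB)" for N
  proof -
    have "(\<lambda>(a, b). (a, u, b)) \<in> MA \<Otimes>\<^sub>M MB \<rightarrow>\<^sub>M MA \<Otimes>\<^sub>M MU \<Otimes>\<^sub>M MB"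
      using u by simp
    then have insert: "(\<lambda>(a, b). (a, u, b)) \<in> N \<rightarrow>\<^sub>M MA \<Otimes>\<^sub>M MU \<Otimes>\<^sub>M MB"
      by (subst measurable_cong_sets[OF N refl])
    have "(\<lambda>(a, u, b). (a, b)) \<in> MA \<Otimes>\<^sub>M MU \<Otimes>\<^sub>M MB \<rightarrow>\<^sub>M MA \<Otimes>\<^sub>M MB"
      by simp
    from distr_distr[OF this insert] show ?thesis
      using N by (simp add: comp_def case_prod_beta' distr_id2)
  qed
  show ?thesis
    by (rule trans[OF forget[OF L, unfolded eq, symmetric] forget[OF L']])
qed

text \<open>
  Within a single environment \<open>t\<close>, where \<open>U\<close> has the constant value \<open>u\<close>, inserting \<open>u\<close> commutes
  both with averaging over \<open>w\<close> and with drawing \<open>y\<close> from \<open>Q z\<close>, because \<open>u\<close> depends on neither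
  \<open>w\<close> nor \<open>z\<close>.
\<close>

context
  fixes W :: "'w measure" and T :: "'t measure" and K :: "'t \<Rightarrow> 'w measure"
    and MY :: "'y measure" and Y :: "'w \<times> 't \<Rightarrow> 'y measure"
    and MZ :: "'z measure" and Z :: "'w \<times> 't \<Rightarrow> 'z measure"
    and MU :: "'u measure" and U :: "'w \<times> 't \<Rightarrow> 'u measure"
    and t :: 't and u :: 'u
  assumes K: "transition_prob_space W T K" and Y: "transitional_rv W T MY Y"
    and Z: "transitional_rv W T MZ Z"
    and t: "t \<in> space T" and u: "u \<in> space MU"
    and U: "\<And>w. w \<in> space W \<Longrightarrow> U (w, t) = return MU u"
begin

lemma env_kernel:
  assumes "transitional_rv W T MV V"
  shows "markov_kernel (K t) MV (\<lambda>w. V (w, t))"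
proof -
  have eq: "sets (K t) = sets W"
    using K t unfolding transition_prob_space_def by (rule kernel_at)
  have "markov_kernel W MV (\<lambda>w. V (w, t))"
    using measurable_compose[OF measurable_Pair2'[OF t] assms[unfolded transitional_rv_def]] .
  then show ?thesis
    by (subst measurable_cong_sets[OF eq refl])
qed

lemma env_space: "space (K t) = space W" "space (K t) \<noteq> {}"
  by (rule kernel_at[OF K[unfolded transition_prob_space_def] t]
      prob_space.not_empty[OF kernel_at(1)[OF K[unfolded transition_prob_space_def] t]])+

lemma kernel_of_Z: "sets (kernel_of K Z t) = sets MZ" "prob_space (kernel_of K Z t)"
proof -
  have "K t \<in> space (prob_algebra (K t))"
    using kernel_at(1)[OF K[unfolded transition_prob_space_def] t] by (simp add: space_prob_algebra)
  from sets_bind'[OF this env_kernel[OF Z]] prob_space_bind'[OF this env_kernel[OF Z]]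
  show "sets (kernel_of K Z t) = sets MZ" "prob_space (kernel_of K Z t)"
    by (simp_all only: kernel_of_def)
qed

lemma sets_kernel_of_YZ: "sets (kernel_of K (Y \<otimes>\<^sub>R Z) t) = sets (MY \<Otimes>\<^sub>M MZ)"
  unfolding kernel_of_def prod_rv_def
  by (rule sets_bind_measurable[OF measurable_prob_algebraD env_space(2)])
    (rule measurable_pair_prob[OF env_kernel[OF Y] env_kernel[OF Z]])

lemma kernel_of_insert_middle:
  "kernel_of K (Y \<otimes>\<^sub>R U \<otimes>\<^sub>R Z) t =
    distr (kernel_of K (Y \<otimes>\<^sub>R Z) t) (MY \<Otimes>\<^sub>M MU \<Otimes>\<^sub>M MZ) (\<lambda>(y, z). (y, u, z))"
proof -
  have "distr (kernel_of K (Y \<otimes>\<^sub>R Z) t) (MY \<Otimes>\<^sub>M MU \<Otimes>\<^sub>M MZ) (\<lambda>(y, z). (y, u, z)) =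
      K t \<bind> (\<lambda>w. distr (Y (w, t) \<Otimes>\<^sub>M Z (w, t)) (MY \<Otimes>\<^sub>M MU \<Otimes>\<^sub>M MZ) (\<lambda>(y, z). (y, u, z)))"
    unfolding kernel_of_def prod_rv_def using u
    by (intro distr_bind[OF measurable_prob_algebraD[OF measurable_pair_prob[OF env_kernel[OF Y]
            env_kernel[OF Z]]] env_space(2)]) simp
  also have "\<dots> = K t \<bind> (\<lambda>w. (Y \<otimes>\<^sub>R U \<otimes>\<^sub>R Z) (w, t))"
    using U by (intro bind_cong refl)
      (simp add: prod_rv_def distr_insert_middle kernel_at[OF env_kernel[OF Y]]
        kernel_at[OF env_kernel[OF Z]] u env_space)
  finally show ?thesis by (simp add: kernel_of_def)
qed

lemma kernel_of_pair_const:
  "kernel_of K (U \<otimes>\<^sub>R Z) t = distr (kernel_of K Z t) (MU \<Otimes>\<^sub>M MZ) (Pair u)"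
proof -
  have "distr (kernel_of K Z t) (MU \<Otimes>\<^sub>M MZ) (Pair u) =
      K t \<bind> (\<lambda>w. distr (Z (w, t)) (MU \<Otimes>\<^sub>M MZ) (Pair u))"
    unfolding kernel_of_def using u
    by (intro distr_bind[OF measurable_prob_algebraD[OF env_kernel[OF Z]] env_space(2)]) simp
  also have "\<dots> = K t \<bind> (\<lambda>w. (U \<otimes>\<^sub>R Z) (w, t))"
  proof (intro bind_cong refl)
    fix w assume w: "w \<in> space (K t)"
    note Zw = kernel_at[OF env_kernel[OF Z] w]
    have "distr (Z (w, t)) (MU \<Otimes>\<^sub>M MZ) (Pair u) = distr (Z (w, t)) (MU \<Otimes>\<^sub>M Z (w, t)) (Pair u)"
      by (intro distr_cong sets_pair_measure_cong refl) (simp add: Zw)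
    then show "distr (Z (w, t)) (MU \<Otimes>\<^sub>M MZ) (Pair u) = (U \<otimes>\<^sub>R Z) (w, t)"
      using w Zw(1) u U by (simp add: prod_rv_def pair_return_eq_distr env_space)
  qed
  finally show ?thesis by (simp add: kernel_of_def)
qed

lemma sets_kernel_prod_YZ:
  assumes "markov_kernel MZ MY Q"
  shows "sets (kernel_prod MZ Q (kernel_of K Z) t) = sets (MY \<Otimes>\<^sub>M MZ)"
  unfolding kernel_prod_def using kernel_of_Z
  by (intro sets_bind'[OF _ measurable_pair_prob[OF assms measurable_return_prob_space]])
    (simp add: space_prob_algebra)

lemma kernel_prod_insert_middle:
  assumes Q: "markov_kernel MZ MY Q"
  shows "kernel_prod (MU \<Otimes>\<^sub>M MZ) (\<lambda>(u, z). Q z) (kernel_of K (U \<otimes>\<^sub>R Z)) t =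
    distr (kernel_prod MZ Q (kernel_of K Z) t) (MY \<Otimes>\<^sub>M MU \<Otimes>\<^sub>M MZ) (\<lambda>(y, z). (y, u, z))"
proof -
  let ?L = "kernel_of K Z t"
  note [measurable_cong] = kernel_of_Z(1)
  have L: "space ?L = space MZ" "space ?L \<noteq> {}"
    using kernel_of_Z prob_space.not_empty by (auto dest: sets_eq_imp_space_eq)
  have meas: "(\<lambda>z. Q z \<Otimes>\<^sub>M return MZ z) \<in> ?L \<rightarrow>\<^sub>M subprob_algebra (MY \<Otimes>\<^sub>M MZ)"
    using measurable_prob_algebraD[OF measurable_pair_prob[OF Q measurable_return_prob_space]]
    by measurable
  have "markov_kernel (MU \<Otimes>\<^sub>M MZ) MY (\<lambda>(u, z). Q z)"
    using measurable_compose[OF measurable_snd Q] by (simp add: case_prod_beta')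
  then have meas': "(\<lambda>x. (case x of (u, z) \<Rightarrow> Q z) \<Otimes>\<^sub>M return (MU \<Otimes>\<^sub>M MZ) x)
      \<in> MU \<Otimes>\<^sub>M MZ \<rightarrow>\<^sub>M subprob_algebra (MY \<Otimes>\<^sub>M MU \<Otimes>\<^sub>M MZ)"
    by (intro measurable_prob_algebraD measurable_pair_prob measurable_return_prob_space)
  have Pair: "Pair u \<in> ?L \<rightarrow>\<^sub>M MU \<Otimes>\<^sub>M MZ" using u by measurable
  have "kernel_prod (MU \<Otimes>\<^sub>M MZ) (\<lambda>(u, z). Q z) (kernel_of K (U \<otimes>\<^sub>R Z)) t =
      ?L \<bind> (\<lambda>z. Q z \<Otimes>\<^sub>M return (MU \<Otimes>\<^sub>M MZ) (u, z))"
    unfolding kernel_prod_def kernel_of_pair_const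
    by (subst bind_distr[OF Pair meas' L(2)]) simp
  also have "\<dots> = ?L \<bind> (\<lambda>z. distr (Q z \<Otimes>\<^sub>M return MZ z) (MY \<Otimes>\<^sub>M MU \<Otimes>\<^sub>M MZ) (\<lambda>(y, z). (y, u, z)))"
  proof (intro bind_cong refl)
    fix z assume "z \<in> space ?L"
    then have z: "z \<in> space MZ" by (simp add: L)
    have "return MU u \<Otimes>\<^sub>M return MZ z = distr (return MZ z) (MU \<Otimes>\<^sub>M MZ) (Pair u)"
      using pair_return_eq_distr[OF prob_space_return[OF z] u]
      by (simp cong: distr_cong sets_pair_measure_cong)
    also have "\<dots> = return (MU \<Otimes>\<^sub>M MZ) (u, z)"
      using u z by (intro distr_return) simp_all
    finally show "Q z \<Otimes>\<^sub>M return (MU \<Otimes>\<^sub>M MZ) (u, z) =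
        distr (Q z \<Otimes>\<^sub>M return MZ z) (MY \<Otimes>\<^sub>M MU \<Otimes>\<^sub>M MZ) (\<lambda>(y, z). (y, u, z))"
      using kernel_at[OF Q z] z u by (simp add: distr_insert_middle prob_space_return)
  qed
  also have "\<dots> = distr (kernel_prod MZ Q (kernel_of K Z) t) (MY \<Otimes>\<^sub>M MU \<Otimes>\<^sub>M MZ) (\<lambda>(y, z). (y, u, z))"
    unfolding kernel_prod_def using u by (intro distr_bind[OF meas L(2), symmetric]) simp
  finally show ?thesis .
qed

lemma env_equation_insert_middle_iff:
  assumes Q: "markov_kernel MZ MY Q"
  shows "kernel_of K (Y \<otimes>\<^sub>R U \<otimes>\<^sub>R Z) t =
      kernel_prod (MU \<Otimes>\<^sub>M MZ) (\<lambda>(u, z). Q z) (kernel_of K (U \<otimes>\<^sub>R Z)) t \<longleftrightarrow>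
    kernel_of K (Y \<otimes>\<^sub>R Z) t = kernel_prod MZ Q (kernel_of K Z) t"
  unfolding kernel_of_insert_middle kernel_prod_insert_middle[OF Q]
  using distr_insert_middle_inj[OF sets_kernel_of_YZ sets_kernel_prod_YZ[OF Q] u] by auto

end

text \<open>
  Since kernels are compared at each \<open>t\<close> separately, a variable that is
  a function of \<open>t\<close> alone is as good as a constant: independence of it says no more than that the
  conditional distribution given \<open>Z\<close> can be chosen free of \<open>t\<close>, which is what the condition
  without \<open>U\<close> already demands.
\<close>

theorem trans_cond_indep_const_iff_precsim_star:
  assumes "transition_prob_space W T K" "transitional_rv W T MY Y" "transitional_rv W T MZ Z"
    and "\<And>t. t \<in> space T \<Longrightarrow> u t \<in> space MU"
    and "\<And>w t. w \<in> space W \<Longrightarrow> t \<in> space T \<Longrightarrow> U (w, t) = return MU (u t)"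
  shows "trans_cond_indep T K MY Y MU U MZ Z \<longleftrightarrow> precsim_star T K MY Y MZ Z"
proof -
  have "kernel_eq T (kernel_of K (Y \<otimes>\<^sub>R U \<otimes>\<^sub>R Z))
        (kernel_prod (MU \<Otimes>\<^sub>M MZ) (\<lambda>(u, z). Q z) (kernel_of K (U \<otimes>\<^sub>R Z))) \<longleftrightarrow>
      kernel_eq T (kernel_of K (Y \<otimes>\<^sub>R Z)) (kernel_prod MZ Q (kernel_of K Z))"
    if "markov_kernel MZ MY Q" for Q
    unfolding kernel_eq_def using assms that by (intro ball_cong refl env_equation_insert_middle_iff)
  then show ?thesis
    unfolding trans_cond_indep_def precsim_star_def by blast
qed

lemma transitional_rv_family_rv:
  assumes "finite S" "\<And>i. i \<in> S \<Longrightarrow> transitional_rv W T (MX i) (X i)"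
  shows "transitional_rv W T (PiM S MX) (family_rv S X)"
  using assms unfolding transitional_rv_def family_rv_def by (rule markov_kernel_PiM)

theorem proposition4p12:
  fixes W :: "'w measure" and T :: "'t measure" and K :: "'t \<Rightarrow> 'w measure"
    and MY :: "'y measure" and Y :: "'w \<times> 't \<Rightarrow> 'y measure"
    and p :: nat and MX :: "nat \<Rightarrow> 'x measure" and X :: "nat \<Rightarrow> 'w \<times> 't \<Rightarrow> 'x measure"
    and S :: "nat set"
  assumes "transition_prob_space W T K"
    and "transitional_rv W T MY Y"
    and "\<And>i. i \<in> {1..p} \<Longrightarrow> transitional_rv W T (MX i) (X i)"
    and "S \<subseteq> {1..p}"
  shows "(invariant_for T K MY Y MX X S \<longleftrightarrow>
            precsim_star T K MY Y (PiM S MX) (family_rv S X)) \<and>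
         (precsim_star T K MY Y (PiM S MX) (family_rv S X) \<longleftrightarrow>
            trans_cond_indep T K MY Y one_point_space delta_star (PiM S MX) (family_rv S X)) \<and>
         (trans_cond_indep T K MY Y one_point_space delta_star (PiM S MX) (family_rv S X) \<longleftrightarrow>
            trans_cond_indep T K MY Y T (env_rv T) (PiM S MX) (family_rv S X))"
proof -
  have "finite S" using assms(4) by (rule finite_subset) simp
  then have Z: "transitional_rv W T (PiM S MX) (family_rv S X)"
    using assms(3,4) by (intro transitional_rv_family_rv) auto
  have "invariant_for T K MY Y MX X S \<longleftrightarrow> precsim_star T K MY Y (PiM S MX) (family_rv S X)"
    unfolding invariant_for_def precsim_star_def ..
  moreover have "trans_cond_indep T K MY Y one_point_space delta_star (PiM S MX) (family_rv S X)
      \<longleftrightarrow> precsim_star T K MY Y (PiM S MX) (family_rv S X)"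
    by (rule trans_cond_indep_const_iff_precsim_star[OF assms(1,2) Z, where u = "\<lambda>_. ()"])
      (simp_all only: delta_star_def dirac_rv_def space_count_space UNIV_I)
  moreover have "trans_cond_indep T K MY Y T (env_rv T) (PiM S MX) (family_rv S X)
      \<longleftrightarrow> precsim_star T K MY Y (PiM S MX) (family_rv S X)"
    by (rule trans_cond_indep_const_iff_precsim_star[OF assms(1,2) Z, where u = "\<lambda>t. t"])
      (simp_all only: env_rv_def dirac_rv_def prod.case)
  ultimately show ?thesis by simp
qed

end
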